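(* In the graceful game, Bob has a winning strategy on every complete bipartite graph $K_{p,q}$ with $p,q\geq 2$ (no matter who starts). Alice has a winning strategy on every star $K_{1,q}$ if she is the first player.
   Context: $K_{p,q}$ is the complete bipartite graph with parts of sizes $p$ and $q$; it has $pq$ edges. A graceful labeling of a graph $G$ with $m$ edges is an injective map $f\colon V(G)\to\{0,1,\dots,m\}$ such that the induced edge labels $|f(u)-f(v)|$, $uv\in E(G)$, are pairwise distinct. The graceful game on a simple graph $G$ with $m$ edges: two players, Alice and Bob, alternately choose a free (not yet labeled) vertex and assign to it a label from $\{0,1,\dots,m\}$ not yet used. An edge both of whose endpoints are labeled gets label $|f(u)-f(v)|$; a move is legal only if after it all edge labels are pairwise distinct. Alice wins if the whole graph ends up gracefully labeled; Bob wins if he can prevent this. Either player may be the first to move. *)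

theory Defs
  imports Main
begin

text \<open>A simple graph is given by its vertex set \<open>V\<close> and its set \<open>E\<close> of two-element edges \<open>{u, v}\<close>.\<close>

definition complete_bipartite :: "nat \<Rightarrow> nat \<Rightarrow> 'v set \<Rightarrow> 'v set set \<Rightarrow> bool" where
  "complete_bipartite p q V E \<longleftrightarrow>
     (\<exists>A B. finite A \<and> finite B \<and> card A = p \<and> card B = q \<and> A \<inter> B = {} \<and>
        V = A \<union> B \<and> E = {{a, b} | a b. a \<in> A \<and> b \<in> B})"

definition distinct_edge_labels :: "'v set set \<Rightarrow> 'v set \<Rightarrow> ('v \<Rightarrow> nat) \<Rightarrow> bool" where
  "distinct_edge_labels E S f \<longleftrightarrow>
     (\<forall>u\<in>S. \<forall>v\<in>S. \<forall>u'\<in>S. \<forall>v'\<in>S.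
        {u, v} \<in> E \<longrightarrow> {u', v'} \<in> E \<longrightarrow>
        \<bar>int (f u) - int (f v)\<bar> = \<bar>int (f u') - int (f v')\<bar> \<longrightarrow> {u, v} = {u', v'})"

definition graceful_labeling :: "'v set \<Rightarrow> 'v set set \<Rightarrow> ('v \<Rightarrow> nat) \<Rightarrow> bool" where
  "graceful_labeling V E f \<longleftrightarrow>
     inj_on f V \<and> f ` V \<subseteq> {0..card E} \<and> distinct_edge_labels E V f"

datatype player = Alice | Bob

fun opponent :: "player \<Rightarrow> player" where
  "opponent Alice = Bob"
| "opponent Bob = Alice"

text \<open>A move is a vertex together with the label assigned to it. A history lists the moves made so
  far in chronological order; since no vertex is labeled twice, \<open>map_of h\<close> is the partial labeling
  reached by the history \<open>h\<close>.\<close>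

type_synonym 'v move = "'v \<times> nat"
type_synonym 'v history = "'v move list"

definition legal_move :: "'v set \<Rightarrow> 'v set set \<Rightarrow> 'v history \<Rightarrow> 'v move \<Rightarrow> bool" where
  "legal_move V E h mv \<longleftrightarrow>
     fst mv \<in> V \<and> fst mv \<notin> dom (map_of h) \<and>
     snd mv \<in> {0..card E} \<and> snd mv \<notin> ran (map_of h) \<and>
     distinct_edge_labels E (dom (map_of (mv # h))) (\<lambda>v. the (map_of (mv # h) v))"

inductive legal_history :: "'v set \<Rightarrow> 'v set set \<Rightarrow> 'v history \<Rightarrow> bool" for V E where
  start: "legal_history V E []"
| step: "legal_history V E h \<Longrightarrow> legal_move V E h mv \<Longrightarrow> legal_history V E (h @ [mv])"

definition finished :: "'v set \<Rightarrow> 'v set set \<Rightarrow> 'v history \<Rightarrow> bool" where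
  "finished V E h \<longleftrightarrow> legal_history V E h \<and> (\<nexists>mv. legal_move V E h mv)"

definition to_move :: "player \<Rightarrow> 'v history \<Rightarrow> player" where
  "to_move first h = (if even (length h) then first else opponent first)"

definition winner :: "'v set \<Rightarrow> 'v set set \<Rightarrow> 'v history \<Rightarrow> player" where
  "winner V E h =
     (if dom (map_of h) = V \<and> graceful_labeling V E (\<lambda>v. the (map_of h v)) then Alice else Bob)"

type_synonym 'v strategy = "'v history \<Rightarrow> 'v move"

text \<open>A strategy must supply a legal move whenever its owner is to move and one exists; otherwise
  the requirement on finished plays in the definition of winning strategies could hold vacuously.\<close>

definition strategy_for ::
    "'v set \<Rightarrow> 'v set set \<Rightarrow> player \<Rightarrow> player \<Rightarrow> 'v strategy \<Rightarrow> bool" where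
  "strategy_for V E first P \<sigma> \<longleftrightarrow>
     (\<forall>h. legal_history V E h \<and> \<not> finished V E h \<and> to_move first h = P \<longrightarrow> legal_move V E h (\<sigma> h))"

definition follows :: "player \<Rightarrow> player \<Rightarrow> 'v strategy \<Rightarrow> 'v history \<Rightarrow> bool" where
  "follows first P \<sigma> h \<longleftrightarrow>
     (\<forall>i < length h. to_move first (take i h) = P \<longrightarrow> h ! i = \<sigma> (take i h))"

definition winning_strategy ::
    "'v set \<Rightarrow> 'v set set \<Rightarrow> player \<Rightarrow> player \<Rightarrow> 'v strategy \<Rightarrow> bool" where
  "winning_strategy V E first P \<sigma> \<longleftrightarrow>
     strategy_for V E first P \<sigma> \<and>
     (\<forall>h. finished V E h \<and> follows first P \<sigma> h \<longrightarrow> winner V E h = P)"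

definition has_winning_strategy :: "'v set \<Rightarrow> 'v set set \<Rightarrow> player \<Rightarrow> player \<Rightarrow> bool" where
  "has_winning_strategy V E first P \<longleftrightarrow> (\<exists>\<sigma>. winning_strategy V E first P \<sigma>)"

end

theory Submission
  imports Defs
begin

text \<open>
  Let \<open>m = p q\<close>. In a graceful labeling of \<open>K\<^bsub>p,q\<^esub>\<close> every difference \<open>1, \<dots>, m\<close> occurs, so \<open>0\<close> and \<open>m\<close>
  lie on opposite sides. Hence a position is lost for Alice as soon as \<open>0\<close> and \<open>m\<close> share a side, or
  \<open>y\<close> and \<open>m - y\<close> with \<open>0 < y < m\<close>, \<open>2 y \<noteq> m\<close> lie on opposite sides. This answers every opening
  \<open>y \<noteq> m / 2\<close> of Alice at once. If she opens with \<open>m / 2\<close>, or if Bob begins, Bob plays \<open>1\<close> (on the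
  side of \<open>m / 2\<close>) and threatens \<open>m - 1\<close> on the other side; Alice can only answer \<open>m - 1\<close> on the
  side of \<open>1\<close>, where the difference \<open>1\<close> is reserved for the edge \<open>0, 1\<close> or \<open>m - 1, m\<close>, and Bob
  destroys it by placing \<open>2\<close> opposite \<open>1\<close> (if the side of \<open>1\<close> is full by then, it
  contains neither \<open>0\<close> nor \<open>m\<close>). On a star Alice labels the centre \<open>0\<close>, and every continuation is graceful.
\<close>

section \<open>Winning positions\<close>

text \<open>Backward induction on the game tree: \<open>P\<close> can force a won end position. Rule
  \<open>opp\<close> excludes finished positions because its universal premise would hold vacuously
  there, whoever has won.\<close>

inductive wins :: "'v set \<Rightarrow> 'v set set \<Rightarrow> player \<Rightarrow> player \<Rightarrow> 'v history \<Rightarrow> bool"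
  for V E first P where
  finish: "finished V E h \<Longrightarrow> winner V E h = P \<Longrightarrow> wins V E first P h"
| own: "to_move first h = P \<Longrightarrow> legal_move V E h mv \<Longrightarrow> wins V E first P (h @ [mv]) \<Longrightarrow>
    wins V E first P h"
| opp: "to_move first h \<noteq> P \<Longrightarrow> \<not> finished V E h \<Longrightarrow>
    (\<And>mv. legal_move V E h mv \<Longrightarrow> wins V E first P (h @ [mv])) \<Longrightarrow> wins V E first P h"

lemma legal_history_snocD:
  assumes "legal_history V E (h @ [mv])"
  shows "legal_history V E h" "legal_move V E h mv"
  using assms by (auto elim: legal_history.cases)

lemma legal_history_appendD: "legal_history V E (h @ t) \<Longrightarrow> legal_history V E h"
  by (induction t rule: rev_induct) (auto simp flip: append_assoc dest: legal_history_snocD)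

lemma legal_history_nthD:
  assumes "legal_history V E h" "i < length h"
  shows "legal_history V E (take i h)" "legal_move V E (take i h) (h ! i)"
proof -
  have "h = take i h @ [h ! i] @ drop (Suc i) h"
    using assms(2) by (simp add: id_take_nth_drop)
  then have "legal_history V E (take i h @ [h ! i])"
    using assms(1) legal_history_appendD by (metis append_assoc)
  then show "legal_history V E (take i h)" "legal_move V E (take i h) (h ! i)"
    by (auto dest: legal_history_snocD)
qed

text \<open>The strategy stays inside \<open>wins\<close> whenever some move does, so every prefix
  of a play following it lies in \<open>wins\<close>; at a finished position only rule
  \<open>finish\<close> can have applied.\<close>

lemma has_winning_strategy_if_wins:
  assumes "wins V E first P []"
  shows "has_winning_strategy V E first P"
proof -
  define good where "good h mv \<longleftrightarrow> legal_move V E h mv \<and> wins V E first P (h @ [mv])" for h mv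
  \<comment> \<open>\<open>strategy_for\<close> demands a legal move at every unfinished position of
    the owner, also where no good move exists; hence the second choice.\<close>
  define \<sigma> where
    "\<sigma> h = (if \<exists>mv. good h mv then SOME mv. good h mv else SOME mv. legal_move V E h mv)" for h
  have good: "good h (\<sigma> h)" if "\<exists>mv. good h mv" for h
    using that someI_ex[OF that] by (simp add: \<sigma>_def)
  have "legal_move V E h (\<sigma> h)" if "legal_history V E h" "\<not> finished V E h" for h
  proof (cases "\<exists>mv. good h mv")
    case True
    then show ?thesis using good good_def by blast
  next
    case False
    have "\<exists>mv. legal_move V E h mv" using that by (auto simp: finished_def)
    from someI_ex[OF this] show ?thesis using False by (simp add: \<sigma>_def)
  qed
  then have strategy: "strategy_for V E first P \<sigma>" by (auto simp: strategy_for_def)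
  have "winner V E h = P" if fin: "finished V E h" and fol: "follows first P \<sigma> h" for h
  proof -
    have leg: "legal_history V E h" using fin by (simp add: finished_def)
    have "i \<le> length h \<Longrightarrow> wins V E first P (take i h)" for i
    proof (induction i)
      case 0
      then show ?case using assms by simp
    next
      case (Suc i)
      then have i: "i < length h" and w: "wins V E first P (take i h)" by auto
      note mv = legal_history_nthD(2)[OF leg i]
      from w have "wins V E first P (take i h @ [h ! i])"
      proof cases
        case finish
        then show ?thesis using mv unfolding finished_def by blast
      next
        case (own mv')
        \<comment> \<open>The move \<open>mv'\<close> need not be the one chosen by
          \<open>\<sigma>\<close>, but it shows that a good move exists, so the chosen one is good
          too.\<close>
        then have "good (take i h) (\<sigma> (take i h))" using good good_def by blast
        then show ?thesis using fol i own(1) by (simp add: follows_def good_def)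
      next
        case opp
        then show ?thesis using mv by blast
      qed
      then show ?case using i by (simp add: take_Suc_conv_app_nth)
    qed
    from this[of "length h"] have "wins V E first P h" by simp
    then show ?thesis using fin by cases (auto simp: finished_def)
  qed
  then show ?thesis
    using strategy unfolding has_winning_strategy_def winning_strategy_def by blast
qed

section \<open>Legal histories as injective partial labelings\<close>

lemma distinct_fst_legal_history: "legal_history V E h \<Longrightarrow> distinct (map fst h)"
  by (induction rule: legal_history.induct) (auto simp: legal_move_def dom_map_of_conv_image_fst)

lemma fst_legal_history: "legal_history V E h \<Longrightarrow> fst ` set h \<subseteq> V"
  by (induction rule: legal_history.induct) (auto simp: legal_move_def)

lemma snd_legal_history: "legal_history V E h \<Longrightarrow> snd ` set h \<subseteq> {0..card E}"
  by (induction rule: legal_history.induct) (auto simp: legal_move_def)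

text \<open>\<open>legal_move\<close> puts the new move in front, while a history grows at its end;
  a fresh vertex makes both lookups agree.\<close>

lemma map_of_snoc:
  "fst mv \<notin> dom (map_of h) \<Longrightarrow> map_of (h @ [mv]) = map_of (mv # h)"
  by (cases mv) (auto simp: map_add_def fun_eq_iff split: option.split)

lemma distinct_snd_legal_history: "legal_history V E h \<Longrightarrow> distinct (map snd h)"
  by (induction rule: legal_history.induct)
    (auto simp: legal_move_def ran_distinct distinct_fst_legal_history)

lemma legal_history_label_inj:
  assumes "legal_history V E h" "(u, k) \<in> set h" "(v, k) \<in> set h"
  shows "u = v"
  using distinct_snd_legal_history[OF assms(1)] assms(2,3)
  by (metis distinct_map inj_onD prod.inject snd_conv)

lemma length_legal_history:
  assumes "finite V" "legal_history V E h"
  shows "length h \<le> card V"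
  using card_mono[OF assms(1) fst_legal_history[OF assms(2)]]
    distinct_card[OF distinct_fst_legal_history[OF assms(2)]] by simp

lemma distinct_edge_labels_legal_history:
  "legal_history V E h \<Longrightarrow> distinct_edge_labels E (dom (map_of h)) (\<lambda>v. the (map_of h v))"
proof (induction rule: legal_history.induct)
  case start
  then show ?case by (simp add: distinct_edge_labels_def)
next
  case (step h mv)
  then have "map_of (h @ [mv]) = map_of (mv # h)" by (intro map_of_snoc) (simp add: legal_move_def)
  then show ?case using step by (simp only: legal_move_def)
qed

text \<open>Each move labels a new vertex, so induction on the number of unlabeled vertices works.
  This settles positions whose outcome no longer depends on the play.\<close>

lemma wins_if_all_plays_win:
  assumes "finite V" "legal_history V E h"
    and "\<And>t. finished V E (h @ t) \<Longrightarrow> winner V E (h @ t) = P"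
  shows "wins V E first P h"
  using assms(2,3)
proof (induction "card V - length h" arbitrary: h rule: less_induct)
  case less
  have step: "wins V E first P (h @ [mv])" if "legal_move V E h mv" for mv
  proof -
    have leg: "legal_history V E (h @ [mv])" using less.prems(1) that by (rule legal_history.step)
    from length_legal_history[OF assms(1) this]
    have "card V - length (h @ [mv]) < card V - length h" by simp
    then show ?thesis
      by (rule less.hyps) (use leg less.prems(2) in \<open>simp_all\<close>)
  qed
  show ?case
  proof (cases "finished V E h")
    case True
    with less.prems(2)[of "[]"] show ?thesis by (auto intro: wins.finish)
  next
    case False
    then obtain mv where "legal_move V E h mv"
      using less.prems(1) by (auto simp: finished_def)
    then show ?thesis using step False by (metis wins.own wins.opp)
  qed
qed

section \<open>Complete bipartite graphs\<close>

text \<open>Orienting each edge from \<open>A\<close> to \<open>B\<close> lists it once, and taking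
  the moves as a set removes their order from the legality condition.\<close>

definition distinct_differences :: "'v set \<Rightarrow> 'v set \<Rightarrow> 'v move set \<Rightarrow> bool" where
  "distinct_differences A B L \<longleftrightarrow>
    (\<forall>(a, x)\<in>L. \<forall>(b, y)\<in>L. \<forall>(a', x')\<in>L. \<forall>(b', y')\<in>L.
      a \<in> A \<longrightarrow> b \<in> B \<longrightarrow> a' \<in> A \<longrightarrow> b' \<in> B \<longrightarrow>
      \<bar>int x - int y\<bar> = \<bar>int x' - int y'\<bar> \<longrightarrow> a = a' \<and> b = b')"

lemma distinct_differencesI:
  assumes "\<And>a x b y a' x' b' y'. (a, x) \<in> L \<Longrightarrow> (b, y) \<in> L \<Longrightarrow> (a', x') \<in> L \<Longrightarrow> (b', y') \<in> L \<Longrightarrow>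
    a \<in> A \<Longrightarrow> b \<in> B \<Longrightarrow> a' \<in> A \<Longrightarrow> b' \<in> B \<Longrightarrow>
    \<bar>int x - int y\<bar> = \<bar>int x' - int y'\<bar> \<Longrightarrow> a = a' \<and> b = b'"
  shows "distinct_differences A B L"
  unfolding distinct_differences_def Ball_def split_paired_All prod.case using assms by metis

lemma distinct_differencesD:
  assumes "distinct_differences A B L"
    "(a, x) \<in> L" "(b, y) \<in> L" "(a', x') \<in> L" "(b', y') \<in> L" "a \<in> A" "b \<in> B" "a' \<in> A" "b' \<in> B"
    "\<bar>int x - int y\<bar> = \<bar>int x' - int y'\<bar>"
  shows "a = a' \<and> b = b'"
  using assms unfolding distinct_differences_def Ball_def split_paired_All prod.case by metis

text \<open>All labeled edges meet at \<open>c\<close>, so only the distances to \<open>k\<close>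
  have to be compared.\<close>

lemma distinct_differences_singleton:
  assumes "\<And>b y. (b, y) \<in> L \<Longrightarrow> b \<in> B \<Longrightarrow> b = c \<and> y = k"
    and "\<And>a x a' x'. (a, x) \<in> L \<Longrightarrow> (a', x') \<in> L \<Longrightarrow> a \<in> A \<Longrightarrow> a' \<in> A \<Longrightarrow>
      \<bar>int x - int k\<bar> = \<bar>int x' - int k\<bar> \<Longrightarrow> a = a'"
  shows "distinct_differences A B L"
  by (rule distinct_differencesI) (metis assms)

lemma distinct_differences_commute:
  assumes "distinct_differences A B L" shows "distinct_differences B A L"
  by (rule distinct_differencesI) (metis distinct_differencesD[OF assms] abs_minus_commute)

locale bipartite =
  fixes A B :: "'v set" and V E and m :: nat
  assumes fin: "finite A" "finite B" and disj: "A \<inter> B = {}"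
    and V: "V = A \<union> B" and E: "E = {{a, b} | a b. a \<in> A \<and> b \<in> B}"
    and m: "m = card A * card B"
begin

lemma swap: "bipartite B A V E m"
proof
  show "E = {{a, b} | a b. a \<in> B \<and> b \<in> A}" unfolding E by (auto simp: insert_commute)
qed (use fin disj V m in auto)

lemma finite_V: "finite V" using fin V by simp

lemma edge_iff: "{u, v} \<in> E \<longleftrightarrow> u \<in> A \<and> v \<in> B \<or> v \<in> A \<and> u \<in> B"
  unfolding E by (auto simp: doubleton_eq_iff)

lemma card_E: "card E = m"
proof -
  have "E = (\<lambda>(a, b). {a, b}) ` (A \<times> B)" unfolding E by auto
  moreover have "inj_on (\<lambda>(a, b). {a, b}) (A \<times> B)"
    using disj by (auto simp: inj_on_def doubleton_eq_iff)
  ultimately show ?thesis by (simp add: card_image card_cartesian_product m)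
qed

lemma distinct_edge_labels_iff:
  "distinct_edge_labels E S f \<longleftrightarrow>
    (\<forall>a\<in>S \<inter> A. \<forall>b\<in>S \<inter> B. \<forall>a'\<in>S \<inter> A. \<forall>b'\<in>S \<inter> B.
      \<bar>int (f a) - int (f b)\<bar> = \<bar>int (f a') - int (f b')\<bar> \<longrightarrow> a = a' \<and> b = b')"
  (is "?L \<longleftrightarrow> ?R")
proof
  assume L: ?L
  show ?R
  proof (intro ballI impI)
    fix a b a' b'
    assume *: "a \<in> S \<inter> A" "b \<in> S \<inter> B" "a' \<in> S \<inter> A" "b' \<in> S \<inter> B"
      and "\<bar>int (f a) - int (f b)\<bar> = \<bar>int (f a') - int (f b')\<bar>"
    then have "{a, b} = {a', b'}"
      using L unfolding distinct_edge_labels_def edge_iff by blast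
    then show "a = a' \<and> b = b'" using * disj by (auto simp: doubleton_eq_iff)
  qed
next
  assume R: ?R
  have R': "{a, b} = {a', b'}" if "a \<in> S \<inter> A" "b \<in> S \<inter> B" "a' \<in> S \<inter> A" "b' \<in> S \<inter> B"
     "\<bar>int (f a) - int (f b)\<bar> = \<bar>int (f a') - int (f b')\<bar>" for a b a' b'
    using R that by blast
  show ?L
    unfolding distinct_edge_labels_def edge_iff
  proof (intro ballI impI)
    fix u v u' v'
    assume *: "u \<in> S" "v \<in> S" "u' \<in> S" "v' \<in> S"
      and uv: "u \<in> A \<and> v \<in> B \<or> v \<in> A \<and> u \<in> B" and uv': "u' \<in> A \<and> v' \<in> B \<or> v' \<in> A \<and> u' \<in> B"
      and eq: "\<bar>int (f u) - int (f v)\<bar> = \<bar>int (f u') - int (f v')\<bar>"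
    show "{u, v} = {u', v'}"
      using uv uv' R'[of u v u' v'] R'[of v u u' v'] R'[of u v v' u'] R'[of v u v' u'] * eq
      by (auto simp: insert_commute abs_minus_commute)
  qed
qed

lemma distinct_edge_labels_iff_distinct_differences:
  "distinct_edge_labels E S f \<longleftrightarrow> distinct_differences A B ((\<lambda>v. (v, f v)) ` S)" (is "?L \<longleftrightarrow> ?R")
proof
  assume ?L
  then show ?R
    unfolding distinct_edge_labels_iff by (intro distinct_differencesI) (elim imageE, simp)
next
  assume R: ?R
  show ?L
    unfolding distinct_edge_labels_iff
    by (intro ballI impI, rule distinct_differencesD[OF R imageI imageI imageI imageI]) auto
qed

text \<open>The vertices of a legal history are distinct, so the partial map and the set of moves
  carry the same information.\<close>

lemma legal_move_iff:
  assumes "legal_history V E h"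
  shows "legal_move V E h (v, x) \<longleftrightarrow>
    v \<in> V \<and> v \<notin> fst ` set h \<and> x \<le> m \<and> x \<notin> snd ` set h \<and>
    distinct_differences A B (insert (v, x) (set h))"
proof (cases "v \<in> fst ` set h")
  case True
  then show ?thesis by (simp add: legal_move_def dom_map_of_conv_image_fst)
next
  case False
  let ?h = "(v, x) # h"
  have dist: "distinct (map fst ?h)"
    using False distinct_fst_legal_history[OF assms] by simp
  have mem: "(a, k) \<in> set ?h \<longleftrightarrow> a \<in> dom (map_of ?h) \<and> the (map_of ?h a) = k" for a k
    using map_of_eq_Some_iff[OF dist, of a k] by (auto simp: domIff)
  have "set ?h = (\<lambda>a. (a, the (map_of ?h a))) ` dom (map_of ?h)"
    unfolding set_eq_iff split_paired_All mem image_iff by blast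
  then have "distinct_edge_labels E (dom (map_of ?h)) (\<lambda>v. the (map_of ?h v)) \<longleftrightarrow>
    distinct_differences A B (set ?h)"
    by (simp only: distinct_edge_labels_iff_distinct_differences)
  then show ?thesis
    using False
    unfolding legal_move_def fst_conv snd_conv card_E
      ran_distinct[OF distinct_fst_legal_history[OF assms]] dom_map_of_conv_image_fst
    by simp
qed

section \<open>Graceful labelings of complete bipartite graphs\<close>

lemma graceful_labeling_iff:
  "graceful_labeling V E f \<longleftrightarrow> inj_on f V \<and> f ` V \<subseteq> {0..m} \<and>
    (\<forall>a\<in>A. \<forall>b\<in>B. \<forall>a'\<in>A. \<forall>b'\<in>B.
      \<bar>int (f a) - int (f b)\<bar> = \<bar>int (f a') - int (f b')\<bar> \<longrightarrow> a = a' \<and> b = b')"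
proof -
  have "V \<inter> A = A" "V \<inter> B = B" using V by auto
  then show ?thesis unfolding graceful_labeling_def distinct_edge_labels_iff card_E by simp
qed

text \<open>Pigeonhole: the \<open>m\<close> edges have distinct differences in
  \<open>{1..m}\<close>, so \<open>m\<close> itself occurs, and labels up to \<open>m\<close>
  produce it only from \<open>0\<close> and \<open>m\<close>.\<close>

lemma graceful_labeling_extremes:
  assumes f: "graceful_labeling V E f" and "0 < m"
  obtains a b where "a \<in> A" "b \<in> B" "f a = 0 \<and> f b = m \<or> f a = m \<and> f b = 0"
proof -
  define d where "d = (\<lambda>(a, b). nat \<bar>int (f a) - int (f b)\<bar>)"
  have le: "f v \<le> m" if "v \<in> V" for v
    using f that by (auto simp: graceful_labeling_iff)
  have ne: "f a \<noteq> f b" if "a \<in> A" "b \<in> B" for a b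
    using f that disj V unfolding graceful_labeling_iff by (metis IntI UnCI empty_iff inj_onD)
  have "inj_on d (A \<times> B)"
    using f unfolding graceful_labeling_iff d_def inj_on_def by auto
  then have "card (d ` (A \<times> B)) = card {1..m}"
    by (simp add: card_image card_cartesian_product m)
  moreover have "d ` (A \<times> B) \<subseteq> {1..m}"
  proof clarify
    fix a b assume "a \<in> A" "b \<in> B"
    with le[of a] le[of b] ne[of a b] V show "d (a, b) \<in> {1..m}" by (auto simp: d_def)
  qed
  ultimately have "d ` (A \<times> B) = {1..m}" by (simp add: card_subset_eq)
  then have "m \<in> d ` (A \<times> B)" using assms(2) by simp
  then obtain a b where ab: "a \<in> A" "b \<in> B" "d (a, b) = m" by auto
  with le[of a] le[of b] V have "f a = 0 \<and> f b = m \<or> f a = m \<and> f b = 0"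
    by (auto simp: d_def)
  with ab that show ?thesis by blast
qed

end

section \<open>The star\<close>

text \<open>With the centre labeled \<open>0\<close>, an edge label is the label of its leaf. Hence
  any free leaf can take any free label, and the play cannot get stuck.\<close>

lemma (in bipartite) Alice_wins_star:
  assumes c: "A = {c}"
  shows "wins V E Alice Alice []"
proof (rule wins.own)
  show "to_move Alice [] = Alice" by (simp add: to_move_def)
  have m_card: "m = card B" using m c by simp
  show leg: "legal_move V E [] (c, 0)"
    unfolding legal_move_iff[OF legal_history.start]
    using c V disj by (auto simp: distinct_differences_def)
  have leg1: "legal_history V E ([] @ [(c, 0)])" using legal_history.start leg by (rule legal_history.step)
  show "wins V E Alice Alice ([] @ [(c, 0)])"
  proof (rule wins_if_all_plays_win[OF finite_V leg1])
    fix t :: "'v history"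
    let ?h = "([] @ [(c, 0)]) @ t"
    assume fin': "finished V E ?h"
    then have leg: "legal_history V E ?h" by (simp add: finished_def)
    note dist = distinct_fst_legal_history[OF leg] distinct_snd_legal_history[OF leg]
    have "fst ` set ?h = V"
    proof (rule ccontr)
      assume "fst ` set ?h \<noteq> V"
      then obtain b where b: "b \<in> V" "b \<notin> fst ` set ?h" using fst_legal_history[OF leg] by blast
      \<comment> \<open>There are \<open>m + 1\<close> vertices and as many labels, so an unlabeled
        vertex leaves a label free.\<close>
      have "card V = Suc m" using V c fin disj m_card by simp
      moreover have "length ?h < card V"
        using psubset_card_mono[OF finite_V, of "fst ` set ?h"] fst_legal_history[OF leg] b
          distinct_card[OF dist(1)] by auto
      moreover have "card (snd ` set ?h) = length ?h" using distinct_card[OF dist(2)] by simp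
      ultimately have "card (snd ` set ?h) < card {0..m}" by simp
      then have "\<not> {0..m} \<subseteq> snd ` set ?h"
        by (meson card_mono finite_imageI finite_set leD)
      then obtain x where "x \<in> {0..m}" and x': "x \<notin> snd ` set ?h" by blast
      with x' have x: "x \<le> m" "x \<notin> snd ` set ?h" by simp_all
      have uniq: "k = 0" if "(c, k) \<in> insert (b, x) (set ?h)" for k
        using that b dist(1) by force
      have inj: "u = v" if "(u, k) \<in> insert (b, x) (set ?h)" "(v, k) \<in> insert (b, x) (set ?h)" for u v k
        using that x(2) legal_history_label_inj[OF leg, of u k v] by force
      have "distinct_differences A B (insert (b, x) (set ?h))"
      \<comment> \<open>The sides are exchanged because the lone vertex is the centre in
        \<open>A\<close>, while the criterion wants it on the second side.\<close>
      proof (rule distinct_differences_commute, rule distinct_differences_singleton)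
        show "d = c \<and> y = 0" if "(d, y) \<in> insert (b, x) (set ?h)" "d \<in> A" for d y
          using that c uniq by auto
        show "u = v" if "(u, k) \<in> insert (b, x) (set ?h)" "(v, l) \<in> insert (b, x) (set ?h)"
          "\<bar>int k - int 0\<bar> = \<bar>int l - int 0\<bar>" for u k v l
          using that inj[of u k v] by simp
      qed
      then have "legal_move V E ?h (b, x)" using b x unfolding legal_move_iff[OF leg] by blast
      then show False using fin' by (auto simp: finished_def)
    qed
    then have dom: "dom (map_of ?h) = V" by (simp add: dom_map_of_conv_image_fst)
    have mem: "map_of ?h v = Some k \<longleftrightarrow> (v, k) \<in> set ?h" for v k
      using dist(1) by (rule map_of_eq_Some_iff)
    have "inj_on (\<lambda>v. the (map_of ?h v)) V"
    proof (rule inj_onI)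
      fix u v assume "u \<in> V" "v \<in> V" "the (map_of ?h u) = the (map_of ?h v)"
      then obtain k where "map_of ?h u = Some k" "map_of ?h v = Some k"
        using dom by (metis domD option.sel)
      then have "(u, k) \<in> set ?h" "(v, k) \<in> set ?h" by (auto simp only: mem)
      then show "u = v" by (rule legal_history_label_inj[OF leg])
    qed
    moreover have "(\<lambda>v. the (map_of ?h v)) ` V \<subseteq> {0..card E}"
    proof
      fix k assume "k \<in> (\<lambda>v. the (map_of ?h v)) ` V"
      then obtain v where "v \<in> dom (map_of ?h)" and k: "k = the (map_of ?h v)"
        unfolding dom by blast
      then have "map_of ?h v = Some k" by (metis domD option.sel)
      then have "(v, k) \<in> set ?h" by (simp only: mem)
      then show "k \<in> {0..card E}" using snd_legal_history[OF leg] by force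
    qed
    ultimately have "graceful_labeling V E (\<lambda>v. the (map_of ?h v))"
      using distinct_edge_labels_legal_history[OF leg] unfolding graceful_labeling_def dom by blast
    then show "winner V E ?h = Alice" using dom by (simp add: winner_def)
  qed
qed

section \<open>Bob's strategy\<close>

text \<open>A static condition: it speaks of all graceful labelings extending \<open>h\<close>, not
  only of those reachable by play.\<close>

definition doomed :: "'v set \<Rightarrow> 'v set set \<Rightarrow> 'v history \<Rightarrow> bool" where
  "doomed V E h \<longleftrightarrow> (\<nexists>f. graceful_labeling V E f \<and> (\<forall>(v, x)\<in>set h. f v = x))"

lemma doomedI:
  assumes "\<And>f. graceful_labeling V E f \<Longrightarrow> (\<And>v x. (v, x) \<in> set h \<Longrightarrow> f v = x) \<Longrightarrow> False"
  shows "doomed V E h"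
  using assms unfolding doomed_def by fast

text \<open>Labels are never changed, so the final labeling of every play extends \<open>h\<close>
  and cannot be graceful.\<close>

lemma wins_Bob_if_doomed:
  assumes "finite V" "legal_history V E h" "doomed V E h"
  shows "wins V E first Bob h"
proof (rule wins_if_all_plays_win[OF assms(1,2)])
  fix t assume "finished V E (h @ t)"
  then have leg: "legal_history V E (h @ t)" by (simp add: finished_def)
  have "the (map_of (h @ t) v) = x" if "(v, x) \<in> set h" for v x
    using map_of_is_SomeI[OF distinct_fst_legal_history[OF leg], of v x] that by simp
  then have "\<not> graceful_labeling V E (\<lambda>v. the (map_of (h @ t) v))"
    using assms(3) unfolding doomed_def by blast
  then show "winner V E (h @ t) = Bob" by (simp add: winner_def)
qed

lemma wins_Bob_by_dooming_move:
  assumes "finite V" "legal_history V E h" "to_move first h = Bob"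
    and "legal_move V E h mv" "doomed V E (h @ [mv])"
  shows "wins V E first Bob h"
  by (rule wins.own[OF assms(3,4) wins_Bob_if_doomed[OF assms(1) legal_history.step[OF assms(2,4)] assms(5)]])

text \<open>If Alice is stuck while a vertex is unlabeled, Bob has already won; otherwise rule
  \<open>opp\<close> applies.\<close>

lemma wins_Bob_opp:
  assumes "legal_history V E h" "to_move first h = Alice" "\<not> V \<subseteq> fst ` set h"
    and "\<And>mv. legal_move V E h mv \<Longrightarrow> wins V E first Bob (h @ [mv])"
  shows "wins V E first Bob h"
proof (cases "finished V E h")
  case True
  have "winner V E h = Bob" using assms(3) by (auto simp: winner_def dom_map_of_conv_image_fst)
  with True show ?thesis by (rule wins.finish)
next
  case False
  with assms show ?thesis by (auto intro: wins.opp)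
qed

section \<open>Obstructions to graceful completion and Bob's play\<close>

context bipartite
begin

lemma doomed_extremes_same_side:
  assumes "0 < m" "u \<in> A" "v \<in> A" "(u, 0) \<in> set h" "(v, m) \<in> set h"
  shows "doomed V E h"
proof (rule doomedI)
  fix f assume f: "graceful_labeling V E f" and h: "\<And>v x. (v, x) \<in> set h \<Longrightarrow> f v = x"
  have "f u = 0" "f v = m" using h assms by blast+
  moreover have "inj_on f V" using f by (simp add: graceful_labeling_iff)
  moreover obtain a b where "a \<in> A" "b \<in> B" "f a = 0 \<and> f b = m \<or> f a = m \<and> f b = 0"
    using graceful_labeling_extremes[OF f assms(1)] .
  ultimately show False using assms disj V by (metis IntI UnCI empty_iff inj_onD)
qed

text \<open>One of the labels \<open>0\<close> and \<open>m\<close> must be in \<open>A\<close>, but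
  no vertex of \<open>A\<close> is left to receive it.\<close>

lemma doomed_no_extremes:
  assumes "0 < m" "A \<subseteq> fst ` set h" "\<And>u x. (u, x) \<in> set h \<Longrightarrow> u \<in> A \<Longrightarrow> x \<noteq> 0 \<and> x \<noteq> m"
  shows "doomed V E h"
proof (rule doomedI)
  fix f assume f: "graceful_labeling V E f" and h: "\<And>v x. (v, x) \<in> set h \<Longrightarrow> f v = x"
  obtain a b where "a \<in> A" "f a = 0 \<or> f a = m"
    using graceful_labeling_extremes[OF f assms(1)] by blast
  moreover obtain x where "(a, x) \<in> set h" using assms(2) \<open>a \<in> A\<close> by force
  ultimately show False using h assms(3) by blast
qed

text \<open>If \<open>0\<close> is on the side of \<open>u\<close>, both extreme labels produce the difference \<open>m - y\<close>;
  if \<open>m\<close> is, both produce \<open>y\<close>.\<close>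

lemma doomed_complementary_opposite:
  assumes "0 < y" "y < m" "2 * y \<noteq> m" "u \<in> A" "v \<in> B" "(u, y) \<in> set h" "(v, m - y) \<in> set h"
  shows "doomed V E h"
proof (rule doomedI)
  fix f assume f: "graceful_labeling V E f" and h: "\<And>v x. (v, x) \<in> set h \<Longrightarrow> f v = x"
  have uv: "f u = y" "f v = m - y" using h assms by blast+
  obtain a b where ab: "a \<in> A" "b \<in> B" "f a = 0 \<and> f b = m \<or> f a = m \<and> f b = 0"
    using graceful_labeling_extremes[OF f] assms by auto
  have "\<bar>int (f a) - int (f v)\<bar> = \<bar>int (f u) - int (f b)\<bar>" using uv ab assms by auto
  then have "a = u" using f ab assms unfolding graceful_labeling_iff by blast
  then show False using uv ab assms by auto
qed

text \<open>The difference \<open>1\<close> is needed between \<open>0\<close> and \<open>1\<close> or between \<open>m - 1\<close> and \<open>m\<close>.\<close>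

lemma doomed_one_taken:
  assumes "3 < m" "u \<in> A" "v \<in> A" "w \<in> B"
    "(u, 1) \<in> set h" "(v, m - 1) \<in> set h" "(w, 2) \<in> set h"
  shows "doomed V E h"
proof (rule doomedI)
  fix f assume f: "graceful_labeling V E f" and h: "\<And>v x. (v, x) \<in> set h \<Longrightarrow> f v = x"
  have uvw: "f u = 1" "f v = m - 1" "f w = 2" using h assms by blast+
  obtain a b where ab: "a \<in> A" "b \<in> B" "f a = 0 \<and> f b = m \<or> f a = m \<and> f b = 0"
    using graceful_labeling_extremes[OF f] assms by auto
  \<comment> \<open>All these differences are \<open>1\<close>: the first alternative holds if
    \<open>b\<close> has label \<open>0\<close>, the second if it has label
    \<open>m\<close>.\<close>
  have "\<bar>int (f u) - int (f w)\<bar> = \<bar>int (f u) - int (f b)\<bar> \<or>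
    \<bar>int (f u) - int (f w)\<bar> = \<bar>int (f v) - int (f b)\<bar>" using uvw ab assms by auto
  then have "w = b" using f ab assms unfolding graceful_labeling_iff by blast
  then show False using uvw ab assms by auto
qed

text \<open>The endgame common to both starting players: Bob has just played \<open>1\<close>,
  either as the opening or beside \<open>m / 2\<close>. The clause \<open>length h = 2\<close>
  records that \<open>m / 2\<close> comes with a second labeled vertex, which bounds
  \<open>m\<close> from below.\<close>

lemma wins_Bob_after_one:
  assumes AB: "2 \<le> card A" "2 \<le> card B"
    and leg: "legal_history V E h" and tm: "to_move first h = Alice"
    and v: "(v, 1) \<in> set h"
    and hA: "\<And>u k. (u, k) \<in> set h \<Longrightarrow> u \<in> A \<and> (k = 1 \<or> 2 * k = m \<and> length h = 2)"
  shows "wins V E first Bob h"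
proof (cases "A \<subseteq> fst ` set h")
  case True
  have "4 \<le> m" using mult_le_mono[OF AB] m by simp
  then have "doomed V E h" using True hA by (intro doomed_no_extremes) force+
  with finite_V leg show ?thesis by (rule wins_Bob_if_doomed)
next
  case False
  have m4: "4 \<le> m" using mult_le_mono[OF AB] m by simp
  have card_h: "card (fst ` set h) = length h"
    using distinct_card[OF distinct_fst_legal_history[OF leg]] by simp
  have hsub: "fst ` set h \<subseteq> A" using hA by force
  have "length h < card A"
    using psubset_card_mono[OF fin(1), of "fst ` set h"] hsub False card_h by auto
  \<comment> \<open>Two labeled vertices and a free one give \<open>card A \<ge> 3\<close>. So
    \<open>m / 2\<close> is at least \<open>3\<close> whenever it is present.\<close>
  then have m6: "6 \<le> m" if "length h = 2"
    using that mult_le_mono[of 3 "card A" 2 "card B"] AB m by simp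
  have hA': "u \<in> A" "k = 1 \<or> 2 * k = m \<and> 6 \<le> m" if "(u, k) \<in> set h" for u k
    using hA[OF that] m6 by auto
  have vA: "v \<in> A" using hA[OF v] by simp
  show ?thesis
  proof (rule wins_Bob_opp[OF leg tm])
    show "\<not> V \<subseteq> fst ` set h" using False V by auto
    fix mv assume mv: "legal_move V E h mv"
    obtain w z where wz: "mv = (w, z)" by (cases mv)
    let ?h = "h @ [(w, z)]"
    have leg': "legal_history V E ?h" using leg mv wz by (auto intro: legal_history.step)
    have tm': "to_move first ?h = Bob"
      using tm by (cases first) (auto simp: to_move_def split: if_splits)
    from mv have w: "w \<in> V" "w \<notin> fst ` set h" "z \<le> m" "z \<notin> snd ` set h"
      and dd: "distinct_differences A B (insert (w, z) (set h))"
      unfolding wz legal_move_iff[OF leg] by auto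
    \<comment> \<open>All earlier moves are in \<open>A\<close>, so Alice's last move blocks at most
      one vertex of \<open>B\<close>; Bob replies at \<open>b\<close>.\<close>
    have "\<not> B \<subseteq> {w}" using AB(2) card_mono[of "{w}" B] by auto
    then obtain b where b: "b \<in> B" "b \<noteq> w" by auto
    have bV: "b \<in> V" "b \<notin> fst ` set ?h" using b V hsub disj by auto
    have wins_by: "wins V E first Bob ?h"
      if "k \<le> m" "k \<notin> snd ` set ?h" "distinct_differences A B (insert (b, k) (set ?h))"
        "doomed V E (?h @ [(b, k)])" for k
      using finite_V leg' tm' _ that(4)
      by (rule wins_Bob_by_dooming_move) (use that bV in \<open>simp add: legal_move_iff[OF leg']\<close>)
    have inj': "a = a'" if "(a, x) \<in> set ?h" "(a', x) \<in> set ?h" for a a' x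
      using that by (rule legal_history_label_inj[OF leg'])
    have all_A: "distinct_differences A B (insert (b, k) (set ?h))"
      if wA: "w \<in> A" and k: "\<And>a x a' y. (a, x) \<in> set ?h \<Longrightarrow> (a', y) \<in> set ?h \<Longrightarrow>
        \<bar>int x - int k\<bar> = \<bar>int y - int k\<bar> \<Longrightarrow> x = y" for k
    proof (rule distinct_differences_singleton)
      have hA: "a \<in> A" if "(a, x) \<in> set ?h" for a x
        using that hA'(1) wA by auto
      show "c = b \<and> y = k" if "(c, y) \<in> insert (b, k) (set ?h)" "c \<in> B" for c y
        using that hA[of c y] disj by auto
      show "a = a'" if "(a, x) \<in> insert (b, k) (set ?h)" "(a', x') \<in> insert (b, k) (set ?h)"
        "a \<in> A" "a' \<in> A" and eq: "\<bar>int x - int k\<bar> = \<bar>int x' - int k\<bar>" for a x a' x'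
      proof -
        have "(a, x) \<in> set ?h" "(a', x') \<in> set ?h" using that b(1) disj by blast+
        with k[OF this eq] inj' show ?thesis by blast
      qed
    qed
    have "wins V E first Bob ?h"
    proof (cases "z = m - 1")
      case z: True
      show ?thesis
      proof (cases "w \<in> B")
        case True
        have "doomed V E ?h"
          by (rule doomed_complementary_opposite[of 1 v w]) (use m4 v vA True z in auto)
        with finite_V leg' show ?thesis by (rule wins_Bob_if_doomed)
      next
        case False
        then have wA: "w \<in> A" using w(1) V by auto
        show ?thesis
        proof (cases "A \<subseteq> fst ` set ?h")
          case True
          have "doomed V E ?h"
          proof (rule doomed_no_extremes[OF _ True])
            show "x \<noteq> 0 \<and> x \<noteq> m" if "(u, x) \<in> set ?h" for u x
              using that hA'(2)[of u x] m4 z by auto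
          qed (use m4 in simp)
          with finite_V leg' show ?thesis by (rule wins_Bob_if_doomed)
        next
          case False
          have "card (fst ` set ?h) = Suc (length h)"
            using distinct_card[OF distinct_fst_legal_history[OF leg']] by simp
          then have "Suc (length h) < card A"
            using psubset_card_mono[OF fin(1), of "fst ` set ?h"] hsub wA False by auto
          \<comment> \<open>With \<open>m / 2\<close> present this yields \<open>m \<ge> 8\<close>.
            For \<open>m = 6\<close> the labels \<open>1\<close> and \<open>3\<close> would both be
            at distance \<open>1\<close> from \<open>2\<close>, making Bob's reply \<open>2\<close>
            illegal.\<close>
          then have "(length h + 2) * 2 \<le> m"
            using mult_le_mono[of "length h + 2" "card A" 2 "card B"] AB m by simp
          moreover have "1 \<le> length h" using v by (cases h) auto
          ultimately have m8: "6 \<le> m" "length h = 2 \<Longrightarrow> 8 \<le> m" by auto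
          then have lab: "k = 1 \<or> 2 * k = m \<and> 8 \<le> m" if "(u, k) \<in> set h" for u k
            using hA[OF that] by auto
          show ?thesis
          proof (rule wins_by[of 2])
            show "2 \<notin> snd ` set ?h" using lab m8 z by fastforce
            show "doomed V E (?h @ [(b, 2)])"
              by (rule doomed_one_taken[of v w b]) (use m8 v vA wA b z in auto)
            have one: "x = y" if "(a, x) \<in> set ?h" "(a', y) \<in> set ?h"
              "\<bar>int x - int 2\<bar> = \<bar>int y - int 2\<bar>" for a a' x y
              using that lab[of a x] lab[of a' y] z m8 by auto
            show "distinct_differences A B (insert (b, 2) (set ?h))"
              using wA one by (intro all_A) auto
          qed (use m8 in simp)
        qed
      qed
    next
      case z: False
      show ?thesis
      proof (rule wins_by[of "m - 1"])
        show "m - 1 \<notin> snd ` set ?h" using hA' m4 z by fastforce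
        show "doomed V E (?h @ [(b, m - 1)])"
          by (rule doomed_complementary_opposite[of 1 v b]) (use m4 v vA b in auto)
        \<comment> \<open>Only the label \<open>m\<close> exceeds \<open>m - 1\<close>. Its mirror
          image \<open>m - 2\<close> is neither \<open>1\<close> nor, since \<open>m \<ge> 6\<close>
          when it is present, \<open>m / 2\<close>.\<close>
        have one: "x = y" if "(a, x) \<in> set ?h" "(a', y) \<in> set ?h"
          "\<bar>int x - int (m - 1)\<bar> = \<bar>int y - int (m - 1)\<bar>" for a a' x y
          using that hA'(2)[of a x] hA'(2)[of a' y] z w(3) m4 by auto
        \<comment> \<open>Here \<open>x\<close> and \<open>y\<close> are \<open>1\<close> or
          \<open>m / 2\<close>. Equality would force \<open>z\<close> to be \<open>1\<close>,
          \<open>m / 2\<close> or \<open>m - 1\<close>, which are excluded, or to leave the range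
          \<open>0..m\<close>.\<close>
        have two: "\<bar>int x - int z\<bar> \<noteq> \<bar>int y - int (m - 1)\<bar>"
          if "(a, x) \<in> set h" "(a', y) \<in> set h" for a a' x y
        proof -
          have "z \<noteq> x" "z \<noteq> y" "z \<noteq> 1" using that v w(4) by force+
          then show ?thesis using hA'(2)[OF that(1)] hA'(2)[OF that(2)] z w(3) m4 by auto
        qed
        show "distinct_differences A B (insert (b, m - 1) (set ?h))"
        proof (cases "w \<in> A")
          case True
          then show ?thesis using one by (rule all_A)
        next
          case False
          have old: "a = a'" if "(a, x) \<in> set h" "(a', x') \<in> set h"
            "\<bar>int x - int z\<bar> = \<bar>int x' - int z\<bar>" for a a' x x'
          proof -
            have "w \<in> B" using False w(1) V by auto
            with that hA'(1) distinct_differencesD[OF dd, of a x w z a' x' w z] show ?thesis by auto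
          qed
          have Bs: "c = w \<and> y = z \<or> c = b \<and> y = m - 1"
            if "(c, y) \<in> insert (b, m - 1) (set ?h)" "c \<in> B" for c y
            using that hA'(1)[of c y] disj by auto
          have As: "(a, x) \<in> set h" if "(a, x) \<in> insert (b, m - 1) (set ?h)" "a \<in> A" for a x
            using that False b disj by auto
          have "a = a' \<and> c = c'"
            if mem: "(a, x) \<in> insert (b, m - 1) (set ?h)" "(c, y) \<in> insert (b, m - 1) (set ?h)"
              "(a', x') \<in> insert (b, m - 1) (set ?h)" "(c', y') \<in> insert (b, m - 1) (set ?h)"
              and sides: "a \<in> A" "c \<in> B" "a' \<in> A" "c' \<in> B"
              and eq: "\<bar>int x - int y\<bar> = \<bar>int x' - int y'\<bar>" for a x c y a' x' c' y'
          proof -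
            have x: "(a, x) \<in> set h" "(a', x') \<in> set h" using As mem sides by blast+
            \<comment> \<open>Two edges at \<open>w\<close> are separated by the legality of Alice's
              move (\<open>old\<close>), two edges at \<open>b\<close> by \<open>one\<close>, and
              mixed pairs by \<open>two\<close>.\<close>
            from Bs[OF mem(2) sides(2)] Bs[OF mem(4) sides(4)] show ?thesis
              using eq x two[OF x] two[OF x(2,1)] old[OF x] one[of a x a' x'] inj'[of a x a'] by auto
          qed
          then show ?thesis by (rule distinct_differencesI)
        qed
      qed simp
    qed
    then show "wins V E first Bob (h @ [mv])" using wz by simp
  qed
qed

lemma Bob_wins_Bob_first:
  assumes "2 \<le> card A" "2 \<le> card B"
  shows "wins V E Bob Bob []"
proof -
  have m4: "4 \<le> m" using mult_le_mono[OF assms] m by simp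
  obtain v where v: "v \<in> A" using assms(1) by fastforce
  have leg: "legal_move V E [] (v, 1)"
    unfolding legal_move_iff[OF legal_history.start]
    using v V m4 disj by (auto simp: distinct_differences_def)
  have "wins V E Bob Bob ([] @ [(v, 1)])"
    by (rule wins_Bob_after_one[OF assms legal_history.step[OF legal_history.start leg]])
      (use v in \<open>auto simp: to_move_def\<close>)
  from wins.own[OF _ leg this] show ?thesis by (simp add: to_move_def)
qed

text \<open>Bob's reply depends on whether \<open>y\<close> is extreme, generic or
  \<open>m / 2\<close>. An opening in \<open>B\<close> reduces to this one by
  \<open>swap\<close>.\<close>

lemma Bob_wins_after_first_move:
  assumes AB: "2 \<le> card A" "2 \<le> card B" and u: "u \<in> A" and leg: "legal_move V E [] (u, y)"
  shows "wins V E Alice Bob [(u, y)]"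
proof -
  have m4: "4 \<le> m" using mult_le_mono[OF AB] m by simp
  have hist: "legal_history V E [(u, y)]" using legal_history.step[OF legal_history.start leg] by simp
  have tm: "to_move Alice [(u, y)] = Bob" by (simp add: to_move_def)
  have y: "y \<le> m" using leg by (simp add: legal_move_iff[OF legal_history.start])
  have "\<not> A \<subseteq> {u}" using AB(1) card_mono[of "{u}" A] by auto
  then obtain v where v: "v \<in> A" "v \<noteq> u" by auto
  obtain w where w: "w \<in> B" using AB(2) by fastforce
  \<comment> \<open>A second vertex on the same side completes no edge, so only the label has to be
    new.\<close>
  have legA: "legal_move V E [(u, y)] (v, x)" if "x \<le> m" "x \<noteq> y" for x
    unfolding legal_move_iff[OF hist]
    using that u v V disj by (auto simp: distinct_differences_def)
  consider "y = 0 \<or> y = m" | "0 < y" "y < m" "2 * y \<noteq> m" | "2 * y = m" using y by linarith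
  then show ?thesis
  proof cases
    case 1
    show ?thesis
      by (rule wins_Bob_by_dooming_move[OF finite_V hist tm legA[of "m - y"]])
        (use 1 m4 u v in \<open>auto intro: doomed_extremes_same_side[of u v] doomed_extremes_same_side[of v u]\<close>)
  next
    case 2
    \<comment> \<open>A single labeled edge cannot conflict, and \<open>2 * y \<noteq> m\<close>
      makes \<open>m - y\<close> a new label.\<close>
    have "legal_move V E [(u, y)] (w, m - y)"
      unfolding legal_move_iff[OF hist]
      using 2 u w V disj by (auto simp: distinct_differences_def)
    moreover have "doomed V E ([(u, y)] @ [(w, m - y)])"
      by (rule doomed_complementary_opposite[OF 2 u w]) auto
    ultimately show ?thesis by (rule wins_Bob_by_dooming_move[OF finite_V hist tm])
  next
    case 3
    then have leg1: "legal_move V E [(u, y)] (v, 1)" using m4 by (intro legA) auto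
    have "wins V E Alice Bob ([(u, y)] @ [(v, 1)])"
      by (rule wins_Bob_after_one[OF AB legal_history.step[OF hist leg1], where v = v])
        (use 3 u v in \<open>auto simp: to_move_def\<close>)
    with tm leg1 show ?thesis by (rule wins.own)
  qed
qed

lemma Bob_wins_Alice_first:
  assumes AB: "2 \<le> card A" "2 \<le> card B"
  shows "wins V E Alice Bob []"
proof (rule wins_Bob_opp[OF legal_history.start])
  show "\<not> V \<subseteq> fst ` set []" using AB(1) V by auto
  fix mv assume mv: "legal_move V E [] mv"
  obtain u y where uy: "mv = (u, y)" by (cases mv)
  have "u \<in> A \<or> u \<in> B" using mv V uy by (simp add: legal_move_def)
  then show "wins V E Alice Bob ([] @ [mv])"
    using Bob_wins_after_first_move[OF AB] bipartite.Bob_wins_after_first_move[OF swap AB(2,1)] mv uy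
    by auto
qed (simp add: to_move_def)

end

theorem theorem4:
  shows "(\<forall>p q. \<forall>(V :: 'v set) E. 2 \<le> p \<longrightarrow> 2 \<le> q \<longrightarrow> complete_bipartite p q V E \<longrightarrow>
            (\<forall>first. has_winning_strategy V E first Bob)) \<and>
         (\<forall>q. \<forall>(V :: 'v set) E. 1 \<le> q \<longrightarrow> complete_bipartite 1 q V E \<longrightarrow>
            has_winning_strategy V E Alice Alice)"
proof (intro conjI allI impI)
  fix p q first and V :: "'v set" and E
  assume "2 \<le> p" "2 \<le> q" "complete_bipartite p q V E"
  then obtain A B where AB: "2 \<le> card A" "2 \<le> card B"
    and bip: "bipartite A B V E (card A * card B)"
    unfolding complete_bipartite_def bipartite_def by blast
  have "wins V E first Bob []"
    using bipartite.Bob_wins_Alice_first[OF bip AB] bipartite.Bob_wins_Bob_first[OF bip AB]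
    by (cases first) auto
  then show "has_winning_strategy V E first Bob" by (rule has_winning_strategy_if_wins)
next
  fix q and V :: "'v set" and E
  assume "complete_bipartite 1 q V E"
  then obtain A B where "card A = 1" and bip: "bipartite A B V E (card A * card B)"
    unfolding complete_bipartite_def bipartite_def by blast
  then obtain c where "A = {c}" by (auto simp: card_1_singleton_iff)
  then have "wins V E Alice Alice []" by (rule bipartite.Alice_wins_star[OF bip])
  then show "has_winning_strategy V E Alice Alice" by (rule has_winning_strategy_if_wins)
qed

end
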